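(* Every $K_3$-free graph is star $2$-choosable. Furthermore, for any $2$-list assignment $L$ of a $K_3$-free graph $G$, a star $L$-coloring of $G$ can be obtained in linear time.
   Context: All graphs are finite and simple. A star of a graph $G$ is a set $W\subseteq V(G)$ with $G[W]\cong K_{1,m}$ for some $m\ge1$; a maximal star is a star not properly contained in another star. A list assignment maps each vertex $v$ to a set $L(v)\subseteq\mathbb N$; a $2$-list assignment has $|L(v)|=2$ for all $v$. An $L$-coloring is a map $\rho$ with $\rho(v)\in L(v)$; a set $W$ is monochromatic if $|\rho(W)|=1$. A star $L$-coloring is an $L$-coloring with no monochromatic maximal star; $G$ is star $k$-choosable if it has a star $L$-coloring for every $k$-list assignment $L$. $K_3$-free means no triangle. *)

theory Defs
  imports "Graph_Theory.Graph_Theory"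
begin

section \<open>Star colorings and star choosability\<close>

text \<open>
  Finite simple graphs are the \<open>pair_graph\<close>s of the library: finite, loop-free, with a symmetric
  set of arcs, so that each undirected edge is present as two arcs. The library predicates
  \<open>complete_digraph n\<close> and \<open>complete_bipartite_digraph m n\<close> say that a graph is (isomorphic to)
  \<open>K\<^sub>n\<close> and \<open>K\<^sub>m\<^sub>,\<^sub>n\<close>, respectively.
\<close>

definition K3_free :: "'a pair_pre_digraph \<Rightarrow> bool" where
  "K3_free G \<longleftrightarrow> \<not> (\<exists>W \<subseteq> pverts G. complete_digraph 3 (with_proj G \<restriction> W))"

definition star :: "'a pair_pre_digraph \<Rightarrow> 'a set \<Rightarrow> bool" where
  "star G W \<longleftrightarrow>
     W \<subseteq> pverts G \<and> (\<exists>m \<ge> 1. complete_bipartite_digraph 1 m (with_proj G \<restriction> W))"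

definition maximal_star :: "'a pair_pre_digraph \<Rightarrow> 'a set \<Rightarrow> bool" where
  "maximal_star G W \<longleftrightarrow> star G W \<and> \<not> (\<exists>W'. star G W' \<and> W \<subset> W')"

definition list_assignment :: "nat \<Rightarrow> 'a pair_pre_digraph \<Rightarrow> ('a \<Rightarrow> nat set) \<Rightarrow> bool" where
  "list_assignment k G L \<longleftrightarrow> (\<forall>v \<in> pverts G. finite (L v) \<and> card (L v) = k)"

definition list_coloring :: "'a pair_pre_digraph \<Rightarrow> ('a \<Rightarrow> nat set) \<Rightarrow> ('a \<Rightarrow> nat) \<Rightarrow> bool" where
  "list_coloring G L \<rho> \<longleftrightarrow> (\<forall>v \<in> pverts G. \<rho> v \<in> L v)"

definition monochromatic :: "('a \<Rightarrow> nat) \<Rightarrow> 'a set \<Rightarrow> bool" where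
  "monochromatic \<rho> W \<longleftrightarrow> card (\<rho> ` W) = 1"

definition star_list_coloring ::
    "'a pair_pre_digraph \<Rightarrow> ('a \<Rightarrow> nat set) \<Rightarrow> ('a \<Rightarrow> nat) \<Rightarrow> bool" where
  "star_list_coloring G L \<rho> \<longleftrightarrow>
     list_coloring G L \<rho> \<and> \<not> (\<exists>W. maximal_star G W \<and> monochromatic \<rho> W)"

definition star_choosable :: "nat \<Rightarrow> 'a pair_pre_digraph \<Rightarrow> bool" where
  "star_choosable k G \<longleftrightarrow> (\<forall>L. list_assignment k G L \<longrightarrow> (\<exists>\<rho>. star_list_coloring G L \<rho>))"


section \<open>Word RAM\<close>

text \<open>
  The machine model for running times: a random access machine with word length \<open>w\<close>, a read-only
  input tape, a write-only output tape and unit-cost instructions. Every value written to memory is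
  reduced modulo \<open>2 ^ w\<close>. There is no
  multiplication, and \<open>Sub\<close> is truncated at 0. The machine has halted when its
  program counter has left the program.
\<close>

datatype instr =
    Const nat nat
  | Copy nat nat
  | Add nat nat nat
  | Sub nat nat nat
  | Load nat nat
  | Store nat nat
  | Read nat
  | Write nat
  | Jump nat
  | JumpEq nat nat nat
  | JumpLess nat nat nat

record ram_state =
  pc :: nat
  mem :: "nat \<Rightarrow> nat"
  inp :: "nat list"
  out :: "nat list"

definition set_mem :: "nat \<Rightarrow> nat \<Rightarrow> nat \<Rightarrow> ram_state \<Rightarrow> ram_state" where
  "set_mem w a v s = s\<lparr>pc := Suc (pc s), mem := (mem s)(a := v mod 2 ^ w)\<rparr>"

fun exec_instr :: "nat \<Rightarrow> instr \<Rightarrow> ram_state \<Rightarrow> ram_state" where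
  "exec_instr w (Const r k) c = set_mem w r k c"
| "exec_instr w (Copy r s) c = set_mem w r (mem c s) c"
| "exec_instr w (Add r s t) c = set_mem w r (mem c s + mem c t) c"
| "exec_instr w (Sub r s t) c = set_mem w r (mem c s - mem c t) c"
| "exec_instr w (Load r s) c = set_mem w r (mem c (mem c s)) c"
| "exec_instr w (Store r s) c = set_mem w (mem c r) (mem c s) c"
| "exec_instr w (Read r) c =
     (case inp c of [] \<Rightarrow> set_mem w r 0 c | x # xs \<Rightarrow> set_mem w r x (c\<lparr>inp := xs\<rparr>))"
| "exec_instr w (Write r) c = c\<lparr>pc := Suc (pc c), out := out c @ [mem c r]\<rparr>"
| "exec_instr w (Jump l) c = c\<lparr>pc := l\<rparr>"
| "exec_instr w (JumpEq r s l) c = c\<lparr>pc := (if mem c r = mem c s then l else Suc (pc c))\<rparr>"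
| "exec_instr w (JumpLess r s l) c = c\<lparr>pc := (if mem c r < mem c s then l else Suc (pc c))\<rparr>"

definition ram_step :: "nat \<Rightarrow> instr list \<Rightarrow> ram_state \<Rightarrow> ram_state" where
  "ram_step w P c = (if pc c < length P then exec_instr w (P ! pc c) c else c)"

definition ram_init :: "nat list \<Rightarrow> ram_state" where
  "ram_init x = \<lparr>pc = 0, mem = (\<lambda>_. 0), inp = x, out = []\<rparr>"

text \<open>
  With word length \<open>w\<close>, program \<open>P\<close> halts on input \<open>x\<close> after at most \<open>t\<close> steps with output \<open>y\<close>
  (halted states are fixed points of \<open>ram_step\<close>).
\<close>

definition ram_outputs_within ::
    "nat \<Rightarrow> instr list \<Rightarrow> nat list \<Rightarrow> nat \<Rightarrow> nat list \<Rightarrow> bool" where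
  "ram_outputs_within w P x t y \<longleftrightarrow>
     (let c = (ram_step w P ^^ t) (ram_init x) in length P \<le> pc c \<and> out c = y)"


section \<open>Input format\<close>

text \<open>
  \<open>encodes_instance G L vs x\<close>: the word sequence \<open>x\<close> describes the graph \<open>G\<close> with 2-list
  assignment \<open>L\<close>, where the vertices are numbered in the order of \<open>vs\<close>. It consists of the number of
  vertices, the number of edges, the two colors of each vertex in turn, and the two end points of
  each edge. The order of the colors in a list, the order of the edges and the order of the end
  points of an edge are arbitrary; each undirected edge occurs exactly once.
\<close>

definition edge_enumeration :: "'a pair_pre_digraph \<Rightarrow> 'a list \<Rightarrow> (nat \<times> nat) list \<Rightarrow> bool" where
  "edge_enumeration G vs es \<longleftrightarrow>
     distinct es \<and>
     (\<forall>(i, j) \<in> set es. i < length vs \<and> j < length vs \<and> (j, i) \<notin> set es) \<and>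
     (\<forall>i < length vs. \<forall>j < length vs.
        (vs ! i, vs ! j) \<in> parcs G \<longleftrightarrow> (i, j) \<in> set es \<or> (j, i) \<in> set es)"

definition encodes_instance ::
    "'a pair_pre_digraph \<Rightarrow> ('a \<Rightarrow> nat set) \<Rightarrow> 'a list \<Rightarrow> nat list \<Rightarrow> bool" where
  "encodes_instance G L vs x \<longleftrightarrow>
     distinct vs \<and> set vs = pverts G \<and>
     (\<exists>cs es.
        length cs = length vs \<and>
        (\<forall>i < length vs. L (vs ! i) = {fst (cs ! i), snd (cs ! i)}) \<and>
        edge_enumeration G vs es \<and>
        x = [length vs, length es] @ concat (map (\<lambda>(a, b). [a, b]) cs)
              @ concat (map (\<lambda>(i, j). [i, j]) es))"

text \<open>
  The number of arcs is twice the number of edges, so a bound linear in this quantity is a bound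
  linear in \<open>|V| + |E|\<close>.
\<close>

definition graph_size :: "'a pair_pre_digraph \<Rightarrow> nat" where
  "graph_size G = card (pverts G) + card (parcs G)"

end

theory Submission
  imports Defs
begin

text \<open>
  In a triangle-free graph the maximal stars are closed neighborhoods of non-isolated vertices, so
  it suffices that every non-isolated vertex has a neighbor of a different color. A single pass over
  the edges achieves this: when an edge has an end point that no earlier edge has touched, that end
  point can still choose the color of its list that differs from the color of the other end point.
\<close>

section \<open>Maximal stars of triangle-free graphs\<close>

text \<open>Puts induced subgraphs into the form to which \<open>complete_digraph_pair_def\<close>
  and \<open>complete_bipartite_digraph_pair_def\<close> apply.\<close>

lemma induce_subgraph_with_proj:
  "with_proj G \<restriction> W = with_proj \<lparr>pverts = W, parcs = parcs G \<inter> W \<times> W\<rparr>"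
  by (auto simp: induce_subgraph_def with_proj_def)

text \<open>The center is the single element of the side of size 1; the other side is nonempty since
  \<open>m\<close> is at least 1. An inclusion is enough, as maximality turns it into an equality
  later.\<close>

lemma starD:
  assumes "star G W"
  obtains v where "v \<in> pverts G" "\<exists>u \<in> W. (v, u) \<in> parcs G"
    "W \<subseteq> insert v {u. (v, u) \<in> parcs G}"
proof -
  from assms obtain m U V where *: "m \<ge> 1" "W \<subseteq> pverts G" "W = U \<union> V" "card U = 1" "card V = m"
    "parcs G \<inter> W \<times> W = U \<times> V \<union> V \<times> U"
    unfolding star_def induce_subgraph_with_proj complete_bipartite_digraph_pair_def by auto
  from * obtain v where v: "U = {v}" by (auto simp: card_1_singleton_iff)
  from * obtain u where u: "u \<in> V" by fastforce
  have "(v, x) \<in> parcs G" if "x \<in> V" for x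
    using *(6) v that by auto
  with * v u that[of v] show ?thesis by blast
qed

text \<open>Two adjacent neighbors of \<open>v\<close> would span a triangle with \<open>v\<close>,
  so the open neighborhood is independent; the given arc makes it nonempty.\<close>

lemma (in pair_graph) closed_neighborhood_star:
  assumes "K3_free G" "(v, u) \<in> parcs G"
  shows "star G (insert v {u. (v, u) \<in> parcs G})"
proof -
  let ?N = "{u. (v, u) \<in> parcs G}"
  have sym: "(y, x) \<in> parcs G" if "(x, y) \<in> parcs G" for x y
    using pair_sym_arcs that by (auto simp: symmetric_def sym_def)
  have loop: "(x, x) \<notin> parcs G" for x using pair_no_loops by fastforce
  have sub: "?N \<subseteq> pverts G" by (auto dest: in_arcsD2)
  have fin: "finite ?N" using sub pair_finite_verts finite_subset by blast
  have indep: "(x, y) \<notin> parcs G" if "x \<in> ?N" "y \<in> ?N" for x y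
  proof
    assume xy: "(x, y) \<in> parcs G"
    let ?W = "{v, x, y}"
    have "v \<noteq> x" "v \<noteq> y" "x \<noteq> y" using loop that xy by auto
    then have "card ?W = 3" by simp
    moreover have "parcs G \<inter> ?W \<times> ?W = {(a, b). (a, b) \<in> ?W \<times> ?W \<and> a \<noteq> b}"
      using loop that xy sym by auto
    moreover have "?W \<subseteq> pverts G" using that by (auto dest: in_arcsD1 in_arcsD2)
    ultimately have "complete_digraph 3 (with_proj G \<restriction> ?W)" "?W \<subseteq> pverts G"
      unfolding induce_subgraph_with_proj complete_digraph_pair_def by simp_all
    with assms(1) show False unfolding K3_free_def by blast
  qed
  have "(x, v) \<in> parcs G \<longleftrightarrow> (v, x) \<in> parcs G" for x using sym by blast
  then have "parcs G \<inter> insert v ?N \<times> insert v ?N = {v} \<times> ?N \<union> ?N \<times> {v}"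
    using indep by (auto simp: loop)
  moreover have "insert v ?N = {v} \<union> ?N" "{v} \<inter> ?N = {}" using loop by auto
  ultimately have "complete_bipartite_digraph 1 (card ?N) (with_proj G \<restriction> insert v ?N)"
    unfolding induce_subgraph_with_proj complete_bipartite_digraph_pair_def
      pair_pre_digraph.select_convs
    using fin by (metis finite_insert is_singletonI is_singleton_altdef)
  moreover have "card ?N \<ge> 1" using fin assms(2) by (auto simp: Suc_le_eq card_gt_0_iff)
  moreover have "insert v ?N \<subseteq> pverts G" using assms(2) sub by (auto dest: in_arcsD1)
  ultimately show ?thesis unfolding star_def by blast
qed

text \<open>A star lies in the closed neighborhood of its center, which is itself a star by
  \<open>closed_neighborhood_star\<close>; maximality leaves only equality.\<close>

lemma (in pair_graph) maximal_star_closed_neighborhood: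
  assumes "K3_free G" "maximal_star G W"
  obtains v where "v \<in> pverts G" "\<exists>u. (v, u) \<in> parcs G" "W = insert v {u. (v, u) \<in> parcs G}"
proof -
  from assms(2) obtain v where v: "v \<in> pverts G" "\<exists>u \<in> W. (v, u) \<in> parcs G"
    "W \<subseteq> insert v {u. (v, u) \<in> parcs G}"
    unfolding maximal_star_def using starD by metis
  moreover from v closed_neighborhood_star[OF assms(1)]
  have "star G (insert v {u. (v, u) \<in> parcs G})" by blast
  ultimately have "W = insert v {u. (v, u) \<in> parcs G}"
    using assms(2) unfolding maximal_star_def by blast
  with v that show ?thesis by blast
qed

text \<open>Reduces star coloring to a local condition: a monochromatic maximal star would be the
  closed neighborhood of a vertex that shares its color with all its neighbors.\<close>

lemma (in pair_graph) star_list_coloringI: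
  assumes "K3_free G" "list_coloring G L \<rho>"
    and "\<And>v u. (v, u) \<in> parcs G \<Longrightarrow> \<exists>u'. (v, u') \<in> parcs G \<and> \<rho> v \<noteq> \<rho> u'"
  shows "star_list_coloring G L \<rho>"
proof -
  have "\<not> monochromatic \<rho> W" if W: "maximal_star G W" for W
  proof
    assume "monochromatic \<rho> W"
    then obtain c where "\<rho> ` W = {c}" by (auto simp: monochromatic_def card_1_singleton_iff)
    moreover obtain v where "\<exists>u. (v, u) \<in> parcs G" "W = insert v {u. (v, u) \<in> parcs G}"
      using maximal_star_closed_neighborhood[OF assms(1) W] by metis
    ultimately show False using assms(3) by (metis image_eqI insertCI mem_Collect_eq singletonD)
  qed
  with assms(2) show ?thesis by (auto simp: star_list_coloring_def)
qed


section \<open>One pass over the edges\<close>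

text \<open>
  Each vertex \<open>v\<close> carries two candidate colors \<open>a v\<close> and \<open>b v\<close>, of which \<open>a v\<close> is the current one.
  A vertex is frozen, which is expressed by \<open>a v = b v\<close>, once an edge at it has been treated.
\<close>

fun color_edge :: "'v \<times> 'v \<Rightarrow> ('v \<Rightarrow> nat) \<times> ('v \<Rightarrow> nat) \<Rightarrow> ('v \<Rightarrow> nat) \<times> ('v \<Rightarrow> nat)" where
  "color_edge (u, v) (a, b) =
     (let y = (if a u = a v then b v else a v);
          x = (if a u = y then b u else a u)
      in (a(u := x, v := y), b(u := x, v := y)))"

text \<open>\<open>E\<close> collects the edges treated so far, so \<open>Field E\<close> is the set
  of frozen vertices. The differently colored neighbor is required along a treated edge: it is then
  frozen too, and the difference cannot be lost.\<close>

definition edge_pass_invariant ::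
    "('v \<Rightarrow> nat) \<Rightarrow> ('v \<Rightarrow> nat) \<Rightarrow> ('v \<times> 'v) set \<Rightarrow> ('v \<Rightarrow> nat) \<times> ('v \<Rightarrow> nat) \<Rightarrow> bool" where
  "edge_pass_invariant a b E = (\<lambda>(a', b').
     (\<forall>v. v \<notin> Field E \<longrightarrow> a' v = a v \<and> b' v = b v) \<and>
     (\<forall>v \<in> Field E. a' v = b' v \<and> a' v \<in> {a v, b v} \<and>
        (\<exists>u. ((v, u) \<in> E \<or> (u, v) \<in> E) \<and> a' v \<noteq> a' u)))"

lemma Field_insert_pair: "Field (insert (u, v) E) = insert u (insert v (Field E))"
  by (auto simp: Field_def)

text \<open>A frozen end point has equal candidates and keeps its color, so old witnesses survive. A
  free end point makes the new edge bichromatic. If both ends are frozen, the edge may stay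
  monochromatic, but both ends already have witnesses.\<close>

lemma color_edge_invariant:
  assumes inv: "edge_pass_invariant a b E (a', b')"
    and "u \<noteq> v" "a u \<noteq> b u" "a v \<noteq> b v"
  shows "edge_pass_invariant a b (insert (u, v) E) (color_edge (u, v) (a', b'))"
proof -
  define y where "y = (if a' u = a' v then b' v else a' v)"
  define x where "x = (if a' u = y then b' u else a' u)"
  have eq: "color_edge (u, v) (a', b') = (a'(u := x, v := y), b'(u := x, v := y))"
    by (simp add: x_def y_def Let_def)
  have out: "a' w = a w" "b' w = b w" if "w \<notin> Field E" for w
    using inv that by (auto simp: edge_pass_invariant_def)
  have inn: "a' w = b' w" "a' w \<in> {a w, b w}"
    "\<exists>z. ((w, z) \<in> E \<or> (z, w) \<in> E) \<and> a' w \<noteq> a' z" if "w \<in> Field E" for w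
    using inv that unfolding edge_pass_invariant_def by blast+
  have mem: "x \<in> {a u, b u}" "y \<in> {a v, b v}"
    using inn(1,2)[of u] inn(1,2)[of v] out[of u] out[of v]
    by (cases "u \<in> Field E"; cases "v \<in> Field E"; auto simp: x_def y_def)+
  have frozen: "x = a' u" if "u \<in> Field E" using inn(1)[OF that] by (simp add: x_def)
  have frozen': "y = a' v" if "v \<in> Field E" using inn(1)[OF that] by (simp add: y_def)
  \<comment> \<open>A free \<open>v\<close> avoids the color of \<open>u\<close>, and then
    \<open>x\<close> is \<open>a' u\<close>. If \<open>v\<close> is frozen, \<open>y\<close> is
    \<open>a' v\<close> and the free \<open>u\<close> avoids it.\<close>
  have neq: "x \<noteq> y" if "u \<notin> Field E \<or> v \<notin> Field E"
    using that out[of u] out[of v] inn(1)[of u] inn(1)[of v] assms(3,4)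
    by (auto simp: x_def y_def)
  let ?a = "a'(u := x, v := y)"
  have old: "?a w = a' w" if "w \<in> Field E" for w using that frozen frozen' by auto
  have "\<exists>z. ((w, z) \<in> insert (u, v) E \<or> (z, w) \<in> insert (u, v) E) \<and> ?a w \<noteq> ?a z"
    if "w \<in> Field (insert (u, v) E)" for w
  proof (cases "w \<in> Field E")
    case True
    from inn(3)[OF this] obtain z where z: "(w, z) \<in> E \<or> (z, w) \<in> E" "a' w \<noteq> a' z" by blast
    then have "z \<in> Field E" by (auto simp: Field_def)
    with old True z show ?thesis by (metis insertCI)
  next
    case False
    with that have "w = u \<or> w = v" by (auto simp: Field_insert_pair)
    with False neq have "x \<noteq> y" by auto
    with \<open>w = u \<or> w = v\<close> \<open>u \<noteq> v\<close> show ?thesis by auto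
  qed
  moreover have "?a w = (b'(u := x, v := y)) w \<and> ?a w \<in> {a w, b w}"
    if "w \<in> Field (insert (u, v) E)" for w
    using that mem inn(1,2)[of w] by (auto simp: Field_insert_pair)
  moreover have "?a w = a w \<and> (b'(u := x, v := y)) w = b w" if "w \<notin> Field (insert (u, v) E)" for w
    using that out[of w] by (auto simp: Field_insert_pair)
  ultimately show ?thesis
    unfolding eq edge_pass_invariant_def prod.case by blast
qed

lemma fold_color_edge_invariant:
  assumes "\<And>u v. (u, v) \<in> set es \<Longrightarrow> u \<noteq> v \<and> a u \<noteq> b u \<and> a v \<noteq> b v"
  shows "edge_pass_invariant a b (set es) (fold color_edge es (a, b))"
  using assms
\<comment> \<open>Reverse induction matches the order of \<open>fold\<close>: the last edge acts on
  the state reached by all earlier ones, while \<open>a\<close> and \<open>b\<close> stay the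
  initial candidates.\<close>
proof (induction es rule: rev_induct)
  case Nil
  show ?case by (simp add: edge_pass_invariant_def Field_def)
next
  case (snoc e es)
  obtain u v where e: "e = (u, v)" by (cases e)
  obtain a' b' where ab: "fold color_edge es (a, b) = (a', b')" by fastforce
  have "edge_pass_invariant a b (set es) (a', b')" using snoc ab by auto
  then have "edge_pass_invariant a b (insert (u, v) (set es)) (color_edge (u, v) (a', b'))"
    using snoc.prems[of u v] e by (intro color_edge_invariant) auto
  with e ab show ?case by simp
qed

text \<open>The numbering \<open>f\<close> lets one statement serve both the existence proof, where
  vertices name themselves, and the program, where they are indices. An edge may be listed in both
  orientations; the later visit finds both ends frozen and changes nothing.\<close>

lemma (in pair_graph) edge_pass_star_coloring:
  fixes f :: "'v \<Rightarrow> 'a"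
  assumes "K3_free G" "list_assignment 2 G L"
    and f: "bij_betw f V (pverts G)"
    and E: "set es \<subseteq> V \<times> V"
      "\<And>i j. i \<in> V \<Longrightarrow> j \<in> V \<Longrightarrow> (f i, f j) \<in> parcs G \<longleftrightarrow> (i, j) \<in> set es \<or> (j, i) \<in> set es"
    and L: "\<And>i. i \<in> V \<Longrightarrow> L (f i) = {a i, b i}"
    and \<rho>: "\<And>i. i \<in> V \<Longrightarrow> \<rho> (f i) = fst (fold color_edge es (a, b)) i"
  shows "star_list_coloring G L \<rho>"
proof -
  obtain a' b' where ab: "fold color_edge es (a, b) = (a', b')" by fastforce
  have surj: "\<exists>i \<in> V. v = f i" if "v \<in> pverts G" for v
    using f that by (auto simp: bij_betw_def)
  have maps: "f i \<in> pverts G" if "i \<in> V" for i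
    using f that by (auto simp: bij_betw_def)
  \<comment> \<open>The list size 2 enters here: a free vertex has a real choice.\<close>
  have dist: "a i \<noteq> b i" if "i \<in> V" for i
  proof -
    have "card {a i, b i} = 2"
      using assms(2) maps[OF that] L[OF that] by (auto simp: list_assignment_def)
    then show ?thesis by auto
  qed
  have "u \<noteq> v" if "(u, v) \<in> set es" for u v
    using that E pair_no_loops[of "(f u, f v)"] by auto
  then have "edge_pass_invariant a b (set es) (a', b')"
    using fold_color_edge_invariant[of es a b] dist E(1) unfolding ab by blast
  \<comment> \<open>A vertex outside the field is isolated; it keeps its first candidate, which lies
    in its list.\<close>
  then have inv: "a' i \<in> {a i, b i}"
      "i \<in> Field (set es) \<Longrightarrow> \<exists>u. ((i, u) \<in> set es \<or> (u, i) \<in> set es) \<and> a' i \<noteq> a' u" for i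
    by (cases "i \<in> Field (set es)"; auto simp: edge_pass_invariant_def)+
  have \<rho>': "\<rho> (f i) = a' i" if "i \<in> V" for i using \<rho>[OF that] ab by simp
  show ?thesis
  proof (rule star_list_coloringI[OF assms(1)])
    show "list_coloring G L \<rho>"
      unfolding list_coloring_def using surj L inv(1) \<rho>' by fastforce
  next
    fix v u assume "(v, u) \<in> parcs G"
    moreover from this obtain i j where ij: "i \<in> V" "j \<in> V" "v = f i" "u = f j"
      using surj by (meson in_arcsD1 in_arcsD2)
    ultimately have "i \<in> Field (set es)" using E(2) by (auto simp: Field_def)
    then obtain k where k: "(i, k) \<in> set es \<or> (k, i) \<in> set es" "a' i \<noteq> a' k" using inv(2) by blast
    moreover from k E(1) have "k \<in> V" by auto
    ultimately have "(v, f k) \<in> parcs G \<and> \<rho> v \<noteq> \<rho> (f k)"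
      using ij(1,3) E(2)[of i k] \<rho>' by simp
    then show "\<exists>u'. (v, u') \<in> parcs G \<and> \<rho> v \<noteq> \<rho> u'" by blast
  qed
qed

lemma (in pair_graph) K3_free_star_2_choosable:
  assumes "K3_free G"
  shows "star_choosable 2 G"
  unfolding star_choosable_def
proof (intro allI impI)
  fix L assume L: "list_assignment 2 G L"
  obtain es where es: "set es = parcs G" using pair_finite_arcs finite_list by blast
  have "\<exists>x y. L v = {x, y}" if "v \<in> pverts G" for v
    using L that unfolding list_assignment_def card_2_iff by blast
  then obtain a b where ab: "\<And>v. v \<in> pverts G \<Longrightarrow> L v = {a v, b v}" by metis
  have "star_list_coloring G L (fst (fold color_edge es (a, b)))"
  proof (rule edge_pass_star_coloring[OF assms L, where f = id])
    show "set es \<subseteq> pverts G \<times> pverts G" using es by (auto dest: in_arcsD1 in_arcsD2)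
  qed (use es ab pair_sym_arcs in \<open>auto simp: symmetric_def sym_def\<close>)
  then show "\<exists>\<rho>. star_list_coloring G L \<rho>" by blast
qed


section \<open>The program\<close>

text \<open>
  The colors of vertex \<open>i\<close> are kept in cells \<open>16 + 2 * i\<close> and \<open>17 + 2 * i\<close>. Register 0 holds the
  number of vertices, 1 the number of edges still to be read, 2 the constant 1, 3 the base address
  16, 4 the end of the color table, and 5 a pointer into it; register 15 is never written and
  stays 0.
\<close>

definition star_program :: "instr list" where
  "star_program = [
     Read 0, Read 1, Const 2 1, Const 3 16, Add 4 0 0, Add 4 4 3, Copy 5 3,
     \<comment> \<open>7: read the colors\<close>
     JumpEq 5 4 12, Read 6, Store 5 6, Add 5 5 2, Jump 7,
     \<comment> \<open>12: treat one edge\<close>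
     JumpEq 1 15 37, Sub 1 1 2,
     Read 6, Add 6 6 6, Add 6 6 3, Read 7, Add 7 7 7, Add 7 7 3, Add 8 6 2, Add 9 7 2,
     Load 10 6, Load 11 7, Load 12 8, Load 13 9,
     JumpEq 10 11 28, Jump 32, Copy 11 13, JumpEq 10 11 31, Jump 32, Copy 10 12,
     Store 6 10, Store 7 11, Store 8 10, Store 9 11, Jump 12,
     \<comment> \<open>37: write the first color of each vertex\<close>
     Copy 5 3, JumpEq 5 4 44, Load 6 5, Write 6, Add 5 5 2, Add 5 5 2, Jump 38]"

section \<open>Timed reachability for symbolic execution\<close>

text \<open>A timed total-correctness assertion. Asking for some moment within the budget
  \<open>t\<close>, not for an exact time, lets branches of different lengths share one
  bound.\<close>

definition reaches :: "nat \<Rightarrow> nat \<Rightarrow> ram_state \<Rightarrow> (ram_state \<Rightarrow> bool) \<Rightarrow> bool" where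
  "reaches w t s Q \<longleftrightarrow> (\<exists>k \<le> t. Q ((ram_step w star_program ^^ k) s))"

lemma reaches_now: "Q s \<Longrightarrow> reaches w t s Q"
  unfolding reaches_def by (intro exI[of _ 0]) simp

lemma reaches_step:
  assumes "pc s < length star_program" "t > 0"
    "reaches w (t - 1) (exec_instr w (star_program ! pc s) s) Q"
  shows "reaches w t s Q"
proof -
  from assms(3) obtain k where "k \<le> t - 1"
    "Q ((ram_step w star_program ^^ k) (exec_instr w (star_program ! pc s) s))"
    by (auto simp: reaches_def)
  then show ?thesis
    unfolding reaches_def using assms(1,2)
    by (intro exI[of _ "Suc k"]) (simp add: ram_step_def funpow_Suc_right del: funpow.simps)
qed

lemma reaches_trans:
  assumes "reaches w t s Q" "\<And>s'. Q s' \<Longrightarrow> reaches w t' s' R"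
  shows "reaches w (t + t') s R"
proof -
  from assms obtain k k' where "k \<le> t" "k' \<le> t'"
    "R ((ram_step w star_program ^^ k') ((ram_step w star_program ^^ k) s))"
    unfolding reaches_def by metis
  then show ?thesis
    unfolding reaches_def by (intro exI[of _ "k' + k"]) (simp add: funpow_add)
qed

text \<open>\<open>ram_outputs_within\<close> inspects the state at time exactly \<open>t'\<close>;
  a halted state is a fixed point, so an earlier halt persists until then.\<close>

lemma reaches_halted_outputs:
  assumes "reaches w t (ram_init x) (\<lambda>s. pc s = length star_program \<and> out s = y)" "t \<le> t'"
  shows "ram_outputs_within w star_program x t' y"
proof -
  from assms(1) obtain k where k: "k \<le> t"
    "pc ((ram_step w star_program ^^ k) (ram_init x)) = length star_program"
    "out ((ram_step w star_program ^^ k) (ram_init x)) = y"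
    unfolding reaches_def by blast
  let ?s = "(ram_step w star_program ^^ k) (ram_init x)"
  have "ram_step w star_program ?s = ?s"
    using k(2) ram_step_def[of w star_program ?s] by simp
  then have "(ram_step w star_program ^^ j) ?s = ?s" for j
    by (induction j) simp_all
  then have "(ram_step w star_program ^^ t') (ram_init x) = ?s"
    using k(1) assms(2) by (metis order_trans comp_apply funpow_add le_add_diff_inverse2)
  with k show ?thesis by (simp add: ram_outputs_within_def Let_def)
qed

lemma reaches_mono: "reaches w t s Q \<Longrightarrow> t \<le> t' \<Longrightarrow> (\<And>s'. Q s' \<Longrightarrow> R s') \<Longrightarrow> reaches w t' s R"
  unfolding reaches_def by (meson order_trans)

section \<open>Reading the color table\<close>

text \<open>Each number costs five instructions, and the exit test one more. The bounds keep
  addresses and values from wrapping modulo \<open>2 ^ w\<close>. The frame condition exempts the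
  pointer 5 and the buffer 6.\<close>

lemma read_colors_loop:
  assumes "p + length xs < 2 ^ w" "16 \<le> p" "\<forall>x \<in> set xs. x < 2 ^ w"
    "m 2 = 1" "m 5 = p" "m 4 = p + length xs"
  shows "reaches w (5 * length xs + 1) \<lparr>pc = 7, mem = m, inp = xs @ r, out = y\<rparr>
    (\<lambda>s. \<exists>m'. s = \<lparr>pc = 12, mem = m', inp = r, out = y\<rparr> \<and>
       (\<forall>i < length xs. m' (p + i) = xs ! i) \<and> (\<forall>q < p. q \<noteq> 5 \<longrightarrow> q \<noteq> 6 \<longrightarrow> m' q = m q))"
  using assms
proof (induction xs arbitrary: p m)
  case Nil
  show ?case
    using Nil by - (rule reaches_step, auto simp: star_program_def intro: reaches_now)
next
  case (Cons x xs)
  define m1 where "m1 = m(6 := x, p := x, 5 := Suc p)"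
  have 1: "reaches w 5 \<lparr>pc = 7, mem = m, inp = (x # xs) @ r, out = y\<rparr>
    (\<lambda>s. s = \<lparr>pc = 7, mem = m1, inp = xs @ r, out = y\<rparr>)"
    using Cons.prems
    apply -
    apply (rule reaches_step, simp add: star_program_def, simp,
      simp add: star_program_def set_mem_def)+
    apply (rule reaches_now)
    apply (simp add: m1_def)
    done
  have 2: "reaches w (5 * length xs + 1) \<lparr>pc = 7, mem = m1, inp = xs @ r, out = y\<rparr>
    (\<lambda>s. \<exists>m'. s = \<lparr>pc = 12, mem = m', inp = r, out = y\<rparr> \<and>
       (\<forall>i < length xs. m' (Suc p + i) = xs ! i) \<and>
       (\<forall>q < Suc p. q \<noteq> 5 \<longrightarrow> q \<noteq> 6 \<longrightarrow> m' q = m1 q))"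
    using Cons.prems by (intro Cons.IH) (auto simp: m1_def)
  have "reaches w (5 + (5 * length xs + 1)) \<lparr>pc = 7, mem = m, inp = (x # xs) @ r, out = y\<rparr>
    (\<lambda>s. \<exists>m'. s = \<lparr>pc = 12, mem = m', inp = r, out = y\<rparr> \<and>
       (\<forall>i < length xs. m' (Suc p + i) = xs ! i) \<and>
       (\<forall>q < Suc p. q \<noteq> 5 \<longrightarrow> q \<noteq> 6 \<longrightarrow> m' q = m1 q))"
    using reaches_trans[OF 1] 2 by blast
  then show ?case
  proof (rule reaches_mono, goal_cases)
    case (2 s)
    then obtain m' where m': "s = \<lparr>pc = 12, mem = m', inp = r, out = y\<rparr>"
      "\<And>i. i < length xs \<Longrightarrow> m' (Suc p + i) = xs ! i"
      "\<And>q. q < Suc p \<Longrightarrow> q \<noteq> 5 \<Longrightarrow> q \<noteq> 6 \<Longrightarrow> m' q = m1 q" by blast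
    \<comment> \<open>Cell \<open>p\<close>, written in this round, survives the remaining rounds by
      their frame condition, since \<open>p < Suc p\<close>.\<close>
    have "m' (p + i) = (x # xs) ! i" if "i < length (x # xs)" for i
      using that m'(2)[of "i - 1"] m'(3)[of p] Cons.prems by (cases i) (auto simp: m1_def)
    moreover have "m' q = m q" if "q < p" "q \<noteq> 5" "q \<noteq> 6" for q
      using m'(3)[of q] that by (simp add: m1_def)
    ultimately show ?case using m'(1) by blast
  qed simp
qed

section \<open>The edge loop\<close>

text \<open>Couples the abstract state of the pass with the memory. The bounds on the entries make
  reduction modulo \<open>2 ^ w\<close> harmless when colors are moved. Registers 1 and 5 vary
  during the loops and are tracked separately.\<close>

definition color_table :: "nat \<Rightarrow> nat \<Rightarrow> (nat \<Rightarrow> nat) \<times> (nat \<Rightarrow> nat) \<Rightarrow> (nat \<Rightarrow> nat) \<Rightarrow> bool" where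
  "color_table w n = (\<lambda>(a, b) m.
     m 2 = 1 \<and> m 3 = 16 \<and> m 4 = 2 * n + 16 \<and> m 15 = 0 \<and>
     (\<forall>i < n. m (2 * i + 16) = a i \<and> m (Suc (2 * i + 16)) = b i \<and> a i < 2 ^ w \<and> b i < 2 ^ w))"

text \<open>The budget 25 is 14 for fetching, at most 6 for choosing the colors, and 5 for storing
  them and jumping back.\<close>

lemma treat_edge:
  assumes "color_table w n ab m" "m 1 = Suc k" "k < 2 ^ w" "2 * n + 17 < 2 ^ w"
    "u < n" "v < n" "u \<noteq> v"
  shows "reaches w 25 \<lparr>pc = 12, mem = m, inp = u # v # r, out = y\<rparr>
    (\<lambda>s. \<exists>m'. s = \<lparr>pc = 12, mem = m', inp = r, out = y\<rparr> \<and> m' 1 = k \<and>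
       color_table w n (color_edge (u, v) ab) m')"
proof -
  obtain a b where ab: "ab = (a, b)" by fastforce
  define p q where "p = 2 * u + 16" and "q = 2 * v + 16"
  \<comment> \<open>Entries of distinct vertices start at distinct even addresses from 16 on, so the
    four cells are pairwise distinct and none is a register.\<close>
  have pq: "u + u < 2 ^ w" "v + v < 2 ^ w" "u < 2 ^ w" "v < 2 ^ w"
    "u + u + 16 = p" "v + v + 16 = q" "Suc p < 2 ^ w" "Suc q < 2 ^ w" "p < 2 ^ w" "q < 2 ^ w"
    "16 \<le> p" "16 \<le> q" "p \<noteq> q" "Suc p \<noteq> q" "p \<noteq> Suc q" "q \<noteq> Suc p" "Suc q \<noteq> p" "q \<noteq> p"
    using assms unfolding p_def q_def by presburger+
  have mm: "m p = a u" "m (Suc p) = b u" "m q = a v" "m (Suc q) = b v" "m 2 = 1" "m 3 = 16" "m 15 = 0"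
     "a u < 2 ^ w" "b u < 2 ^ w" "a v < 2 ^ w" "b v < 2 ^ w"
    using assms by (auto simp: color_table_def ab p_def q_def)
  define y' where "y' = (if a u = a v then b v else a v)"
  define x' where "x' = (if a u = y' then b u else a u)"
  have val: "x' < 2 ^ w" "y' < 2 ^ w" using mm by (auto simp: x'_def y'_def)
  have eq: "color_edge (u, v) ab = (a(u := x', v := y'), b(u := x', v := y'))"
    by (simp add: x'_def y'_def Let_def ab)
  \<comment> \<open>\<open>m1\<close>, \<open>m2\<close> and \<open>m3\<close> are the memories
    after fetching, after choosing and after storing.\<close>
  define m1 where "m1 = m(1 := k, 6 := p, 7 := q, 8 := Suc p, 9 := Suc q,
    10 := a u, 11 := a v, 12 := b u, 13 := b v)"
  define m2 where "m2 = m1(10 := x', 11 := y')"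
  define m3 where "m3 = m2(p := x', q := y', Suc p := x', Suc q := y')"
  have 1: "reaches w 14 \<lparr>pc = 12, mem = m, inp = u # v # r, out = y\<rparr>
    (\<lambda>s. s = \<lparr>pc = 26, mem = m1, inp = r, out = y\<rparr>)"
    using pq mm assms(2-4)
    apply -
    apply (rule reaches_step, simp add: star_program_def, simp,
      simp add: star_program_def set_mem_def)+
    apply (rule reaches_now)
    apply (simp add: m1_def fun_upd_twist)
    done
  have 2: "reaches w 6 \<lparr>pc = 26, mem = m1, inp = r, out = y\<rparr>
    (\<lambda>s. s = \<lparr>pc = 32, mem = m2, inp = r, out = y\<rparr>)"
  proof -
    \<comment> \<open>These are the three paths through the branches, of 2, 4 and 4 steps. On the
      first, the program skips the second test; this is sound because \<open>y'\<close> is then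
      \<open>a v\<close>, whence \<open>x'\<close> is \<open>a u\<close>.\<close>
    consider "a u \<noteq> a v" | "a u = a v" "a u \<noteq> b v" | "a u = a v" "a u = b v" by blast
    then show ?thesis
    proof cases
      case 1
      then show ?thesis
        using mm
        apply -
        apply (rule reaches_mono[where t = 2])
        apply (rule reaches_step, simp add: star_program_def, simp,
          simp add: star_program_def set_mem_def m1_def)+
        apply (rule reaches_now)
        apply (simp_all add: m2_def m1_def x'_def y'_def fun_upd_twist)
        done
    next
      case 2
      then show ?thesis
        using mm
        apply -
        apply (rule reaches_mono[where t = 4])
        apply (rule reaches_step, simp add: star_program_def, simp,
          simp add: star_program_def set_mem_def m1_def)+
        apply (rule reaches_now)
        apply (simp_all add: m2_def m1_def x'_def y'_def fun_upd_twist)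
        done
    next
      case 3
      then show ?thesis
        using mm
        apply -
        apply (rule reaches_mono[where t = 4])
        apply (rule reaches_step, simp add: star_program_def, simp,
          simp add: star_program_def set_mem_def m1_def)+
        apply (rule reaches_now)
        apply (simp_all add: m2_def m1_def x'_def y'_def fun_upd_twist)
        done
    qed
  qed
  have regs: "m2 6 = p" "m2 7 = q" "m2 8 = Suc p" "m2 9 = Suc q" "m2 10 = x'" "m2 11 = y'"
    by (simp_all add: m2_def m1_def)
  have reg: "r \<noteq> p" "r \<noteq> q" "r \<noteq> Suc p" "r \<noteq> Suc q" if "r < 16" for r
    using pq(11,12) that by auto
  have 3: "reaches w 5 \<lparr>pc = 32, mem = m2, inp = r, out = y\<rparr>
    (\<lambda>s. s = \<lparr>pc = 12, mem = m3, inp = r, out = y\<rparr>)"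
    apply (rule reaches_step, simp add: star_program_def, simp,
      simp add: star_program_def set_mem_def regs reg val)+
    apply (rule reaches_now)
    apply (simp add: m3_def)
    done
  have m2: "m2 i = m i" if "i = 2 \<or> i = 3 \<or> i = 4 \<or> i = 15 \<or> 16 \<le> i" for i
    using that by (auto simp: m2_def m1_def)
  have "m3 1 = k" using pq(11,12) by (simp add: m3_def m2_def m1_def)
  moreover have "m3 2 = 1" "m3 3 = 16" "m3 4 = 2 * n + 16" "m3 15 = 0"
    using assms(1) by (simp_all add: m3_def m2 reg color_table_def ab)
  moreover have "m3 (2 * i + 16) = (a(u := x', v := y')) i \<and>
      m3 (Suc (2 * i + 16)) = (b(u := x', v := y')) i \<and>
      (a(u := x', v := y')) i < 2 ^ w \<and> (b(u := x', v := y')) i < 2 ^ w" if "i < n" for i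
  proof -
    define c where "c = 2 * i + 16"
    have "c = p \<longleftrightarrow> i = u" "c = q \<longleftrightarrow> i = v" "c \<noteq> Suc p" "c \<noteq> Suc q" "Suc c \<noteq> p" "Suc c \<noteq> q"
      unfolding c_def p_def q_def by presburger+
    moreover have "m2 c = a i" "m2 (Suc c) = b i" "a i < 2 ^ w" "b i < 2 ^ w"
      using assms(1) that m2[of c] m2[of "Suc c"] by (auto simp: color_table_def ab c_def)
    ultimately show ?thesis
      using val unfolding c_def[symmetric] m3_def by simp
  qed
  ultimately have "m3 1 = k" "color_table w n (color_edge (u, v) ab) m3"
    unfolding eq by (simp_all add: color_table_def)
  moreover have "reaches w (6 + 5) \<lparr>pc = 26, mem = m1, inp = r, out = y\<rparr>
    (\<lambda>s. s = \<lparr>pc = 12, mem = m3, inp = r, out = y\<rparr>)"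
    using reaches_trans[OF 2] 3 by blast
  then have "reaches w (14 + (6 + 5)) \<lparr>pc = 12, mem = m, inp = u # v # r, out = y\<rparr>
    (\<lambda>s. s = \<lparr>pc = 12, mem = m3, inp = r, out = y\<rparr>)"
    using reaches_trans[OF 1] by blast
  ultimately show ?thesis by (elim reaches_mono) auto
qed

lemma treat_all_edges:
  assumes "color_table w n ab m" "m 1 = length es" "length es < 2 ^ w" "2 * n + 17 < 2 ^ w"
    "\<And>u v. (u, v) \<in> set es \<Longrightarrow> u < n \<and> v < n \<and> u \<noteq> v"
  shows "reaches w (25 * length es + 1)
    \<lparr>pc = 12, mem = m, inp = concat (map (\<lambda>(i, j). [i, j]) es), out = y\<rparr>
    (\<lambda>s. \<exists>m'. s = \<lparr>pc = 37, mem = m', inp = [], out = y\<rparr> \<and>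
       color_table w n (fold color_edge es ab) m')"
  using assms
proof (induction es arbitrary: ab m)
  case Nil
  then have "m 15 = 0" by (auto simp: color_table_def)
  with Nil show ?case
    by - (rule reaches_step, auto simp: star_program_def intro: reaches_now)
next
  case (Cons e es)
  obtain u v where e: "e = (u, v)" by (cases e)
  let ?i = "concat (map (\<lambda>(i, j). [i, j]) es)"
  have "reaches w 25 \<lparr>pc = 12, mem = m, inp = u # v # ?i, out = y\<rparr>
    (\<lambda>s. \<exists>m'. s = \<lparr>pc = 12, mem = m', inp = ?i, out = y\<rparr> \<and> m' 1 = length es \<and>
       color_table w n (color_edge (u, v) ab) m')"
    using Cons.prems(1-4) Cons.prems(5)[of u v] e by (intro treat_edge) auto
  then have "reaches w (25 + (25 * length es + 1)) \<lparr>pc = 12, mem = m, inp = u # v # ?i, out = y\<rparr>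
    (\<lambda>s. \<exists>m'. s = \<lparr>pc = 37, mem = m', inp = [], out = y\<rparr> \<and>
       color_table w n (fold color_edge es (color_edge (u, v) ab)) m')"
  proof (rule reaches_trans, goal_cases)
    case (1 s)
    then obtain m' where m': "s = \<lparr>pc = 12, mem = m', inp = ?i, out = y\<rparr>" "m' 1 = length es"
      "color_table w n (color_edge (u, v) ab) m'" by blast
    show ?case unfolding m'(1) using Cons.prems(3-5) m'(2,3) by (intro Cons.IH) auto
  qed
  then show ?case by (simp add: e add.assoc)
qed

section \<open>Writing the coloring\<close>

text \<open>The induction is on the number \<open>k\<close> of vertices still to be written. A round
  takes six instructions; its two increments skip the second candidate.\<close>

lemma write_colors_loop:
  assumes "color_table w n (a, b) m" "m 5 = 2 * i + 16" "i + k = n" "2 * n + 17 < 2 ^ w"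
  shows "reaches w (6 * k + 1) \<lparr>pc = 38, mem = m, inp = r, out = y\<rparr>
    (\<lambda>s. pc s = 44 \<and> out s = y @ map a [i..<n])"
  using assms
proof (induction k arbitrary: i m y)
  case 0
  then have "m 5 = m 4" by (auto simp: color_table_def)
  with 0 show ?case
    by - (rule reaches_step, auto simp: star_program_def intro: reaches_now)
next
  case (Suc k)
  define m1 where "m1 = m(6 := a i, 5 := Suc (Suc (2 * i + 16)))"
  have mm: "m 4 = 2 * n + 16" "m 2 = 1" "m (2 * i + 16) = a i" "a i < 2 ^ w"
    "Suc (Suc (2 * i + 16)) < 2 ^ w" "i < n"
    using Suc.prems by (auto simp: color_table_def)
  have 1: "reaches w 6 \<lparr>pc = 38, mem = m, inp = r, out = y\<rparr>
    (\<lambda>s. s = \<lparr>pc = 38, mem = m1, inp = r, out = y @ [a i]\<rparr>)"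
    using mm Suc.prems(2)
    apply -
    apply (rule reaches_step, simp add: star_program_def, simp,
      simp add: star_program_def set_mem_def)+
    apply (rule reaches_now)
    apply (simp add: m1_def fun_upd_twist)
    done
  have 2: "reaches w (6 * k + 1) \<lparr>pc = 38, mem = m1, inp = r, out = y @ [a i]\<rparr>
    (\<lambda>s. pc s = 44 \<and> out s = (y @ [a i]) @ map a [Suc i..<n])"
    using Suc.prems by (intro Suc.IH) (auto simp: m1_def color_table_def)
  have "reaches w (6 + (6 * k + 1)) \<lparr>pc = 38, mem = m, inp = r, out = y\<rparr>
    (\<lambda>s. pc s = 44 \<and> out s = (y @ [a i]) @ map a [Suc i..<n])"
    using reaches_trans[OF 1] 2 by blast
  moreover have "(y @ [a i]) @ map a [Suc i..<n] = y @ map a [i..<n]"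
    using mm by (simp add: upt_conv_Cons)
  ultimately show ?case by (simp add: add.assoc)
qed

section \<open>The whole program\<close>

lemma length_concat_pairs: "length (concat (map (\<lambda>(a, b). [a, b]) ps)) = 2 * length ps"
  by (induction ps) auto

lemma nth_concat_pairs:
  "i < length ps \<Longrightarrow> concat (map (\<lambda>(a, b). [a, b]) ps) ! (2 * i) = fst (ps ! i) \<and>
     concat (map (\<lambda>(a, b). [a, b]) ps) ! Suc (2 * i) = snd (ps ! i)"
proof (induction ps arbitrary: i)
  case (Cons p ps)
  then show ?case by (cases i; cases p) auto
qed simp

text \<open>The time adds up as 7 for initialization, \<open>10 * length cs + 1\<close> for reading
  (two colors per vertex), \<open>25 * length es + 1\<close> for the edges, and
  \<open>6 * length cs + 2\<close> for resetting the pointer and writing.\<close>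

lemma star_program_outputs:
  assumes x: "x = [length cs, length es] @ concat (map (\<lambda>(a, b). [a, b]) cs)
              @ concat (map (\<lambda>(i, j). [i, j]) es)"
    and bound: "\<forall>z \<in> set x. z < 2 ^ w" "2 * length cs + 17 < 2 ^ w"
    and es: "\<And>u v. (u, v) \<in> set es \<Longrightarrow> u < length cs \<and> v < length cs \<and> u \<noteq> v"
    and t: "16 * length cs + 25 * length es + 11 \<le> t"
  shows "ram_outputs_within w star_program x t
    (map (fst (fold color_edge es (\<lambda>i. fst (cs ! i), \<lambda>i. snd (cs ! i)))) [0..<length cs])"
proof -
  let ?n = "length cs" and ?xs = "concat (map (\<lambda>(a, b). [a, b]) cs)"
    and ?r = "concat (map (\<lambda>(i, j). [i, j]) es)"
  let ?ab = "(\<lambda>i. fst (cs ! i), \<lambda>i. snd (cs ! i))"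
  obtain a b where ab: "fold color_edge es ?ab = (a, b)" by fastforce
  define m :: "nat \<Rightarrow> nat"
    where "m = (\<lambda>_. 0)(0 := ?n, 1 := length es, 2 := 1, 3 := 16, 4 := 2 * ?n + 16, 5 := 16)"
  have len: "length es < 2 ^ w" "?n < 2 ^ w" "\<forall>z \<in> set ?xs. z < 2 ^ w" using bound(1) x by auto
  \<comment> \<open>With word length 0 the constant 1 would be stored as 0.\<close>
  have "0 < w" using bound(2) by (cases w) auto
  then have 1: "reaches w 7 (ram_init x) (\<lambda>s. s = \<lparr>pc = 7, mem = m, inp = ?xs @ ?r, out = []\<rparr>)"
    using len bound(2) unfolding x ram_init_def
    apply -
    apply (rule reaches_step, simp add: star_program_def, simp,
      simp add: star_program_def set_mem_def)+
    apply (rule reaches_now)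
    apply (simp add: m_def fun_upd_twist)
    done
  have 2: "reaches w (5 * length ?xs + 1) \<lparr>pc = 7, mem = m, inp = ?xs @ ?r, out = []\<rparr>
    (\<lambda>s. \<exists>m'. s = \<lparr>pc = 12, mem = m', inp = ?r, out = []\<rparr> \<and> m' 1 = length es \<and>
       color_table w ?n ?ab m')"
  proof (rule reaches_mono[OF read_colors_loop[where p = 16]], goal_cases)
    case (8 s)
    then obtain m' where m': "s = \<lparr>pc = 12, mem = m', inp = ?r, out = []\<rparr>"
      "\<And>i. i < length ?xs \<Longrightarrow> m' (16 + i) = ?xs ! i"
      "\<And>q. q < 16 \<Longrightarrow> q \<noteq> 5 \<Longrightarrow> q \<noteq> 6 \<Longrightarrow> m' q = m q" by blast
    \<comment> \<open>Positions \<open>2 * i\<close> and \<open>Suc (2 * i)\<close> of the flattened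
      color list land at these addresses because the table starts at 16.\<close>
    have "m' (2 * i + 16) = fst (cs ! i) \<and> m' (Suc (2 * i + 16)) = snd (cs ! i) \<and>
        fst (cs ! i) < 2 ^ w \<and> snd (cs ! i) < 2 ^ w" if "i < ?n" for i
    proof -
      have j: "2 * i < length ?xs" "Suc (2 * i) < length ?xs"
        using that by (simp_all add: length_concat_pairs)
      have "m' (2 * i + 16) = fst (cs ! i)" "m' (Suc (2 * i + 16)) = snd (cs ! i)"
        using m'(2)[OF j(1)] m'(2)[OF j(2)] nth_concat_pairs[OF that] by (simp_all add: add.commute)
      moreover have "fst (cs ! i) < 2 ^ w" "snd (cs ! i) < 2 ^ w"
        using nth_mem[OF j(1)] nth_mem[OF j(2)] nth_concat_pairs[OF that] len(3) by metis+
      ultimately show ?thesis by blast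
    qed
    moreover have "m' 1 = length es" using m'(3)[of 1] by (simp add: m_def)
    ultimately show ?case using m'(1,3) by (auto simp: color_table_def m_def)
  qed (use len bound in \<open>auto simp: m_def length_concat_pairs\<close>)
  have 4: "reaches w (1 + (6 * ?n + 1)) \<lparr>pc = 37, mem = m', inp = [], out = []\<rparr>
      (\<lambda>s. pc s = 44 \<and> out s = map a [0..<?n])"
    if "color_table w ?n (a, b) m'" for m'
  proof -
    have "color_table w ?n (a, b) (m'(5 := 16))" "m' 3 = 16" "16 < (2 :: nat) ^ w"
      using that bound(2) by (auto simp: color_table_def)
    with write_colors_loop[OF this(1), of 0 ?n "[]" "[]"] bound(2) show ?thesis
      by - (rule reaches_step, auto simp: star_program_def set_mem_def)
  qed
  have "reaches w (7 + ((5 * length ?xs + 1) + ((25 * length es + 1) + (1 + (6 * ?n + 1)))))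
      (ram_init x) (\<lambda>s. pc s = 44 \<and> out s = map a [0..<?n])"
  proof (rule reaches_trans[OF 1], erule ssubst, rule reaches_trans[OF 2],
      elim exE conjE, erule ssubst)
    fix m' :: "nat \<Rightarrow> nat"
    assume "m' 1 = length es" "color_table w ?n ?ab m'"
    then have 3: "reaches w (25 * length es + 1) \<lparr>pc = 12, mem = m', inp = ?r, out = []\<rparr>
      (\<lambda>s. \<exists>m'. s = \<lparr>pc = 37, mem = m', inp = [], out = []\<rparr> \<and> color_table w ?n (a, b) m')"
      unfolding ab[symmetric] using len(1) bound(2) es by (intro treat_all_edges) auto
    show "reaches w (25 * length es + 1 + (1 + (6 * ?n + 1)))
        \<lparr>pc = 12, mem = m', inp = ?r, out = []\<rparr>
        (\<lambda>s. pc s = 44 \<and> out s = map a [0..<?n])"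
      by (rule reaches_trans[OF 3], elim exE conjE, erule ssubst, erule 4)
  qed
  moreover have "length star_program = 44" by (simp add: star_program_def)
  ultimately show ?thesis
    unfolding ab fst_conv using t
    by (intro reaches_halted_outputs) (simp_all add: length_concat_pairs ac_simps)
qed

section \<open>Encoded instances and the linear bound\<close>

text \<open>Each listed edge is sent to one of its arcs, injectively because \<open>vs\<close> is
  distinct.\<close>

lemma edge_enumeration_length:
  assumes "edge_enumeration G vs es" "distinct vs" "finite (parcs G)"
  shows "length es \<le> card (parcs G)"
proof -
  let ?f = "\<lambda>(i, j). (vs ! i, vs ! j)"
  have bounds: "i < length vs" "j < length vs" if "(i, j) \<in> set es" for i j
    using assms(1) that by (auto simp: edge_enumeration_def)
  have "inj_on ?f (set es)"
    using assms(2) bounds by (auto simp: inj_on_def nth_eq_iff_index_eq)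
  moreover have "?f ` set es \<subseteq> parcs G"
    using assms(1) bounds by (auto simp: edge_enumeration_def)
  ultimately have "card (set es) \<le> card (parcs G)" using assms(3) card_inj_on_le by blast
  then show ?thesis using assms(1) by (simp add: edge_enumeration_def distinct_card)
qed

lemma star_program_correct:
  assumes "pair_graph G" "K3_free G" "list_assignment 2 G L" "encodes_instance G L vs x"
    "\<forall>a \<in> set x. a < 2 ^ w" "64 * (graph_size G + 1) \<le> 2 ^ w"
  shows "\<exists>\<rho>. star_list_coloring G L \<rho> \<and>
    ram_outputs_within w star_program x (64 * (graph_size G + 1)) (map \<rho> vs)"
proof -
  interpret pair_graph G by fact
  from assms(4) obtain cs es where enc: "distinct vs" "set vs = pverts G"
    "length cs = length vs" "\<And>i. i < length vs \<Longrightarrow> L (vs ! i) = {fst (cs ! i), snd (cs ! i)}"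
    "edge_enumeration G vs es"
    "x = [length cs, length es] @ concat (map (\<lambda>(a, b). [a, b]) cs)
          @ concat (map (\<lambda>(i, j). [i, j]) es)"
    unfolding encodes_instance_def by metis
  have size: "length cs + length es \<le> graph_size G"
    using edge_enumeration_length[OF enc(5,1) pair_finite_arcs] distinct_card[OF enc(1)] enc(2,3)
    by (simp add: graph_size_def)
  \<comment> \<open>A pair \<open>(i, i)\<close> would be its own reversal, which the enumeration
    forbids.\<close>
  have es: "u < length vs \<and> v < length vs \<and> u \<noteq> v" if "(u, v) \<in> set es" for u v
    using enc(5) that by (auto simp: edge_enumeration_def)
  define a where "a = fst (fold color_edge es (\<lambda>i. fst (cs ! i), \<lambda>i. snd (cs ! i)))"
  \<comment> \<open>Transports the computed colors from indices to vertices by inverting the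
    numbering.\<close>
  define \<rho> where "\<rho> v = a (the_inv_into {..<length vs} ((!) vs) v)" for v
  have bij: "bij_betw ((!) vs) {..<length vs} (pverts G)"
    using bij_betw_nth enc(1,2) by blast
  then have \<rho>: "\<rho> (vs ! i) = a i" if "i < length vs" for i
    using that by (simp add: \<rho>_def bij_betw_def the_inv_into_f_f)
  have "star_list_coloring G L \<rho>"
  proof (rule edge_pass_star_coloring[OF assms(2,3) bij])
    show "set es \<subseteq> {..<length vs} \<times> {..<length vs}" using es by auto
    show "((vs ! i, vs ! j) \<in> parcs G) \<longleftrightarrow> (i, j) \<in> set es \<or> (j, i) \<in> set es"
      if "i \<in> {..<length vs}" "j \<in> {..<length vs}" for i j
      using enc(5) that by (simp add: edge_enumeration_def)
    show "L (vs ! i) = {fst (cs ! i), snd (cs ! i)}" if "i \<in> {..<length vs}" for i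
      using enc(4) that by simp
    show "\<rho> (vs ! i) = fst (fold color_edge es (\<lambda>i. fst (cs ! i), \<lambda>i. snd (cs ! i))) i"
      if "i \<in> {..<length vs}" for i
      using \<rho> that by (simp add: a_def)
  qed
  moreover have "ram_outputs_within w star_program x (64 * (graph_size G + 1))
      (map a [0..<length cs])"
    \<comment> \<open>The constant 64 covers both needs: it dominates the coefficients 16, 25 and 11
      of the running time, and it makes \<open>2 ^ w\<close> exceed
      \<open>2 * length cs + 17\<close>, so the table is addressable.\<close>
    unfolding a_def using enc(3,6) assms(5,6) es size by (intro star_program_outputs) auto
  moreover have "map a [0..<length cs] = map \<rho> vs"
    using \<rho> enc(3) by (intro nth_equalityI) auto
  ultimately show ?thesis by auto
qed

theorem theorem16:
  shows "(\<forall>G :: 'a pair_pre_digraph. pair_graph G \<and> K3_free G \<longrightarrow> star_choosable 2 G) \<and>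
    (\<exists>(P :: instr list) (c :: nat). \<forall>(G :: 'a pair_pre_digraph) L vs x w.
       pair_graph G \<and> K3_free G \<and> list_assignment 2 G L \<and> encodes_instance G L vs x \<and>
       (\<forall>a \<in> set x. a < 2 ^ w) \<and> c * (graph_size G + 1) \<le> 2 ^ w \<longrightarrow>
       (\<exists>\<rho>. star_list_coloring G L \<rho> \<and>
            ram_outputs_within w P x (c * (graph_size G + 1)) (map \<rho> vs)))"
proof (intro conjI allI impI)
  fix G :: "'a pair_pre_digraph"
  assume "pair_graph G \<and> K3_free G"
  then show "star_choosable 2 G" by (simp add: pair_graph.K3_free_star_2_choosable)
qed (intro exI[of _ star_program] exI[of _ 64] allI impI, elim conjE, rule star_program_correct)

end
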